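(* Let $A_0>0$ and $p>0$, and let $f(x)=A_0x^{p}$ for $x>0$. Then for every $a>0$ the quantities $\bar x(a)$, $\bar y(a)$ defined in the context satisfy \[ \bar x(a)=\frac{p+1}{p+2}\,a,\qquad \bar y(a)=\frac{p+1}{2(2p+1)}\,A_0\,a^{p}, \] and hence $\bar y(a)=\lambda f(\bar x(a))$ for all $a>0$ with \[ \lambda=\frac{p+1}{2(2p+1)}\left(\frac{p+2}{p+1}\right)^{p}. \]
   Context: For $a>0$, \[ \bar x(a)=\frac{\int_0^a x f(x)\,dx}{\int_0^a f(x)\,dx},\qquad \bar y(a)=\frac12\,\frac{\int_0^a f(x)^2\,dx}{\int_0^a f(x)\,dx} \] are the centroid coordinates of the region $\{0\le x\le a,\ 0\le y\le f(x)\}$. *)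

theory Defs
  imports "HOL-Analysis.Analysis"
begin

definition centroid_x :: "(real \<Rightarrow> real) \<Rightarrow> real \<Rightarrow> real" where
  "centroid_x f a = integral {0..a} (\<lambda>x. x * f x) / integral {0..a} f"

definition centroid_y :: "(real \<Rightarrow> real) \<Rightarrow> real \<Rightarrow> real" where
  "centroid_y f a = 1 / 2 * (integral {0..a} (\<lambda>x. (f x)\<^sup>2) / integral {0..a} f)"

end

theory Submission
  imports Defs
begin

text \<open>Power functions integrate explicitly: \<open>integral_eq_powr_from_0\<close> evaluates
  the three integrals, with exponents \<open>p\<close>, \<open>p + 1\<close> and
  \<open>2 * p\<close>, and \<open>a powr (p + 1)\<close> cancels in both quotients. The abscissa is
  thus proportional to \<open>a\<close> and the ordinate to \<open>a powr p\<close>; as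
  \<open>f\<close> turns a positive multiple of \<open>a\<close> into a multiple of
  \<open>a powr p\<close>, the ratio of the ordinate to \<open>f\<close> at the abscissa is constant
  in \<open>a\<close>.\<close>

text \<open>Nothing is assumed about \<open>f 0\<close>, so the integrands agree with powers only off the
  null set \<open>{0}\<close>.\<close>

lemma integral_eq_powr_from_0:
  fixes g :: "real \<Rightarrow> real"
  assumes "q > -1" and "a \<ge> 0" and eq: "\<And>x. x > 0 \<Longrightarrow> g x = c * x powr q"
  shows "integral {0..a} g = c * (a powr (q + 1) / (q + 1))"
proof -
  have "((\<lambda>x. c * x powr q) has_integral c * (a powr (q + 1) / (q + 1))) {0..a}"
    using has_integral_powr_from_0[OF assms(1,2)] by (rule has_integral_mult_right)
  then have "(g has_integral c * (a powr (q + 1) / (q + 1))) {0..a}"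
    by (rule has_integral_spike_finite[where S = "{0}", rotated 2]) (auto simp: eq)
  then show ?thesis
    by (rule integral_unique)
qed

theorem mainTheorem3:
  fixes A\<^sub>0 p :: real and f :: "real \<Rightarrow> real"
  assumes "A\<^sub>0 > 0" and "p > 0"
    and "\<And>x. x > 0 \<Longrightarrow> f x = A\<^sub>0 * x powr p"
  shows "(\<forall>a>0. centroid_x f a = (p + 1) / (p + 2) * a
              \<and> centroid_y f a = (p + 1) / (2 * (2 * p + 1)) * A\<^sub>0 * a powr p)
       \<and> (let lam = (p + 1) / (2 * (2 * p + 1)) * ((p + 2) / (p + 1)) powr p
          in \<forall>a>0. centroid_y f a = lam * f (centroid_x f a))"
proof -
  note A = assms(1) and p = assms(2) and f = assms(3)
  have x: "centroid_x f a = (p + 1) / (p + 2) * a"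
    and y: "centroid_y f a = (p + 1) / (2 * (2 * p + 1)) * A\<^sub>0 * a powr p" if a: "a > 0" for a
  proof -
    have area: "integral {0..a} f = A\<^sub>0 * (a powr (p + 1) / (p + 1))"
      using p a f by (intro integral_eq_powr_from_0) auto
    have "integral {0..a} (\<lambda>x. x * f x) = A\<^sub>0 * (a powr (p + 1 + 1) / (p + 1 + 1))"
      using p a by (intro integral_eq_powr_from_0) (auto simp: f powr_add)
    \<comment> \<open>Splits off the power that cancels against \<open>area\<close>.\<close>
    moreover have "a powr (p + 1 + 1) = a * a powr (p + 1)"
      using a by (simp add: powr_mult_base add_ac)
    ultimately show "centroid_x f a = (p + 1) / (p + 2) * a"
      unfolding centroid_x_def area using A p a by (simp add: field_simps)
    have sq: "integral {0..a} (\<lambda>x. (f x)\<^sup>2) = A\<^sub>0\<^sup>2 * (a powr (2 * p + 1) / (2 * p + 1))"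
      using p a
      by (intro integral_eq_powr_from_0)
        (auto simp: f power_mult_distrib power2_eq_square simp flip: powr_add)
    \<comment> \<open>Again isolates the factor shared with \<open>area\<close>, which leaves
      \<open>a powr p\<close>.\<close>
    have pw: "a powr (2 * p + 1) = a powr p * a powr (p + 1)"
      by (simp flip: powr_add)
    show "centroid_y f a = (p + 1) / (2 * (2 * p + 1)) * A\<^sub>0 * a powr p"
      unfolding centroid_y_def area sq pw using A p a by (simp add: divide_simps power2_eq_square)
  qed
  have "centroid_y f a
      = (p + 1) / (2 * (2 * p + 1)) * ((p + 2) / (p + 1)) powr p * f (centroid_x f a)"
    if a: "a > 0" for a
  proof -
    \<comment> \<open>The second factor of the constant is chosen to undo the scaling of
      \<open>a\<close> in the abscissa: the two fractions are reciprocal.\<close>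
    have "((p + 2) / (p + 1)) powr p * ((p + 1) / (p + 2) * a) powr p = a powr p"
      using p a by (simp flip: powr_mult)
    \<comment> \<open>The formula for \<open>f\<close> holds only at positive arguments, so the
      abscissa must be seen to be positive.\<close>
    moreover have "f (centroid_x f a) = A\<^sub>0 * ((p + 1) / (p + 2) * a) powr p"
      unfolding x[OF a] using p a by (intro f) simp
    ultimately show ?thesis
      unfolding y[OF a] by (simp add: mult_ac)
  qed
  then show ?thesis
    using x y by (simp add: Let_def)
qed

end
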